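(* Let $\mathbb{F}$ be a field and let $f \colon \mathbb{F} \to \mathbb{F}$ be an SD map. Then: (1) if $\mathbb{F}$ is $\mathbb{Q}$, $\mathbb{R}$, or any Euclidean subfield of $\mathbb{R}$, then $f$ is the identity map; (2) if $\mathbb{F}$ is any quadratic extension of $\mathbb{Q}$ (i.e. $[\mathbb{F}:\mathbb{Q}]=2$), then $f$ is either the identity map or the conjugate map.
   Context: An SD map on a field $\mathbb{F}$ is a function $f\colon \mathbb{F}\to\mathbb{F}$ such that for all $x \neq y$ in $\mathbb{F}$ one has $f(x)\neq f(y)$ and $f\left(\frac{x+y}{x-y}\right) = \frac{f(x)+f(y)}{f(x)-f(y)}$. A subfield of $\mathbb{R}$ (with the order induced from $\mathbb{R}$) is Euclidean if every nonnegative element of it has a square root in it. For a quadratic extension $\mathbb{F}=\mathbb{Q}(\sqrt{d})$ ($d\in\mathbb{Q}$, $\sqrt d\notin\mathbb{Q}$), the conjugate map is $a+b\sqrt{d}\mapsto a-b\sqrt{d}$ for $a,b\in\mathbb{Q}$, i.e. the nontrivial field automorphism of $\mathbb{F}$. *)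

theory Defs
  imports Complex_Main
begin

text \<open>
  A field is rendered as a subfield \<open>F\<close> of an ambient type of class \<open>field\<close>;
  \<open>F = UNIV\<close> gives the type itself.
\<close>

definition is_subfield :: "'a::field set \<Rightarrow> bool" where
  "is_subfield F \<longleftrightarrow>
     0 \<in> F \<and> 1 \<in> F \<and>
     (\<forall>x\<in>F. \<forall>y\<in>F. x + y \<in> F \<and> x * y \<in> F) \<and>
     (\<forall>x\<in>F. - x \<in> F \<and> inverse x \<in> F)"

definition SD_map :: "'a::field set \<Rightarrow> ('a \<Rightarrow> 'a) \<Rightarrow> bool" where
  "SD_map F f \<longleftrightarrow>
     (\<forall>x\<in>F. f x \<in> F) \<and>
     (\<forall>x\<in>F. \<forall>y\<in>F. x \<noteq> y \<longrightarrow>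
        f x \<noteq> f y \<and> f ((x + y) / (x - y)) = (f x + f y) / (f x - f y))"

definition identity_map_on :: "'a set \<Rightarrow> ('a \<Rightarrow> 'a) \<Rightarrow> bool" where
  "identity_map_on F f \<longleftrightarrow> (\<forall>x\<in>F. f x = x)"

definition Euclidean_subfield :: "real set \<Rightarrow> bool" where
  "Euclidean_subfield F \<longleftrightarrow>
     is_subfield F \<and> (\<forall>x\<in>F. 0 \<le> x \<longrightarrow> (\<exists>y\<in>F. y\<^sup>2 = x))"

interpretation rat_vector_space:
  vector_space "\<lambda>(q::rat) (x::'a::field_char_0). of_rat q * x"
  by unfold_locales (simp_all add: algebra_simps of_rat_add of_rat_mult)

definition quadratic_extension_of_rat :: "'a::field_char_0 set \<Rightarrow> bool" where
  "quadratic_extension_of_rat F \<longleftrightarrow>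
     is_subfield F \<and>
     vector_space.dim (\<lambda>(q::rat) (x::'a). of_rat q * x) F = 2"

text \<open>
  Here \<open>r\<close> plays the role of the square root of \<open>d\<close>. The map does not
  depend on the choice of \<open>r\<close>: any two choices in \<open>F\<close> are rational multiples
  of each other.
\<close>

definition conjugate_map_on :: "'a::field_char_0 set \<Rightarrow> ('a \<Rightarrow> 'a) \<Rightarrow> bool" where
  "conjugate_map_on F f \<longleftrightarrow>
     (\<exists>(d::rat) r. r\<^sup>2 = of_rat d \<and> r \<notin> \<rat> \<and>
        F = {of_rat a + of_rat b * r | a b. True} \<and>
        (\<forall>a b. f (of_rat a + of_rat b * r) = of_rat a - of_rat b * r))"

end

theory Submission
  imports Defs
begin

text \<open>
  Comparing the equation for \<open>(x, y)\<close> with the one for \<open>(x / y, 1)\<close> shows that an SD map is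
  multiplicative. Computing \<open>f 5\<close> from \<open>5 = 3 + 2\<close> and from \<open>5 = 4 + 1\<close> then forces \<open>f 2 = 2\<close>,
  whence \<open>f\<close> fixes the prime field \<open>\<rat>\<close>. On a Euclidean field \<open>f\<close> maps squares to squares, so it
  is strictly increasing and hence the identity. On \<open>\<rat>(r)\<close> with \<open>r\<^sup>2 \<in> \<rat>\<close> it maps \<open>r\<close> to
  \<open>s = r\<close> or \<open>s = - r\<close> and, up to sign, \<open>a + b r\<close> to \<open>a + b s\<close>; a negative sign at \<open>x\<close> would
  force both \<open>x\<^sup>2 = - 1\<close> and \<open>(2 x)\<^sup>2 = - 1\<close>.
\<close>

section \<open>SD maps on a subfield of characteristic zero\<close>

locale sd_map =
  fixes F :: "'a::field_char_0 set" and f :: "'a \<Rightarrow> 'a"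
  assumes subfield: "is_subfield F" and SD: "SD_map F f"
begin

lemma zero_mem [simp]: "0 \<in> F"
  and one_mem [simp]: "1 \<in> F"
  and add_mem [simp]: "x \<in> F \<Longrightarrow> y \<in> F \<Longrightarrow> x + y \<in> F"
  and mult_mem [simp]: "x \<in> F \<Longrightarrow> y \<in> F \<Longrightarrow> x * y \<in> F"
  and uminus_mem [simp]: "x \<in> F \<Longrightarrow> - x \<in> F"
  and inverse_mem [simp]: "x \<in> F \<Longrightarrow> inverse x \<in> F"
  using subfield by (auto simp: is_subfield_def)

lemma diff_mem [simp]: "x \<in> F \<Longrightarrow> y \<in> F \<Longrightarrow> x - y \<in> F"
  using add_mem[of x "- y"] by simp

lemma divide_mem [simp]: "x \<in> F \<Longrightarrow> y \<in> F \<Longrightarrow> x / y \<in> F"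
  by (simp add: divide_inverse)

lemma of_nat_mem [simp]: "of_nat n \<in> F"
  by (induction n) auto

lemma numeral_mem [simp]: "numeral n \<in> F"
  using of_nat_mem[of "numeral n"] by simp

lemma of_int_mem [simp]: "of_int i \<in> F"
  by (cases i rule: int_cases2) auto

lemma of_rat_mem [simp]: "of_rat q \<in> F"
  by (cases q) (simp add: of_rat_rat)

lemma inj: "x \<in> F \<Longrightarrow> y \<in> F \<Longrightarrow> f x = f y \<longleftrightarrow> x = y"
  using SD by (auto simp: SD_map_def)

lemma quotient:
  "x \<in> F \<Longrightarrow> y \<in> F \<Longrightarrow> x \<noteq> y \<Longrightarrow> f ((x + y) / (x - y)) = (f x + f y) / (f x - f y)"
  using SD by (auto simp: SD_map_def)

text \<open>For nonzero \<open>x\<close> the pair \<open>(x, 0)\<close> has quotient 1, which gives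
  the same linear relation between \<open>f x\<close> and \<open>f 0\<close> for every such
  \<open>x\<close>. The distinct values \<open>f 1\<close> and \<open>f 2\<close> can both satisfy
  it only if \<open>f 1 = 1\<close>.\<close>

lemma f_one [simp]: "f 1 = 1" and f_zero [simp]: "f 0 = 0"
proof -
  have *: "f x * (f 1 - 1) = f 0 * (f 1 + 1)" if "x \<in> F" "x \<noteq> 0" for x
  proof -
    have "f 1 = (f x + f 0) / (f x - f 0)"
      using quotient[of x 0] that by simp
    moreover have "f x - f 0 \<noteq> 0" using that inj[of x 0] by simp
    ultimately show ?thesis by (simp add: field_simps)
  qed
  have "f 1 * (f 1 - 1) = f 2 * (f 1 - 1)" using *[of 1] *[of 2] by simp
  moreover have "f 1 \<noteq> f 2" using inj[of 1 2] by simp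
  ultimately show "f 1 = 1" by simp
  with *[of 1] show "f 0 = 0" by simp
qed

lemma f_eq_0_iff [simp]: "x \<in> F \<Longrightarrow> f x = 0 \<longleftrightarrow> x = 0"
  using inj[of x 0] by simp

text \<open>The pair \<open>(x, - x)\<close> has quotient 0, so the numerator on the right of the SD
  equation vanishes.\<close>

lemma f_uminus [simp]: assumes "x \<in> F" shows "f (- x) = - f x"
proof (cases "x = 0")
  case False
  then have "x \<noteq> - x" by simp
  then have "(f x + f (- x)) / (f x - f (- x)) = 0" "f x \<noteq> f (- x)"
    using quotient[of x "- x"] inj[of x "- x"] assms by auto
  then show ?thesis by (simp add: eq_neg_iff_add_eq_0 add.commute)
qed simp

text \<open>The fraction \<open>(t + 1) / (t - 1)\<close> determines \<open>t\<close>, and it takes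
  the same value at \<open>f (x / y)\<close> and at \<open>f x / f y\<close>. The case
  \<open>y = 0\<close> relies on \<open>x / 0 = 0\<close> and \<open>f 0 = 0\<close>.\<close>

lemma f_divide: assumes "x \<in> F" "y \<in> F" shows "f (x / y) = f x / f y"
proof -
  consider "y = 0" | "y \<noteq> 0" "x = y" | "y \<noteq> 0" "x \<noteq> y" by blast
  then show ?thesis
  proof cases
    case 3
    then have ne: "x / y \<noteq> 1" by simp
    have "(x / y + 1) / (x / y - 1) = (x + y) / (x - y)"
      using 3 by (simp add: divide_simps)
    then have "(f (x / y) + 1) / (f (x / y) - 1) = (f x + f y) / (f x - f y)"
      using quotient[of "x / y" 1] quotient[of x y] 3 ne assms by simp
    moreover have "f (x / y) - 1 \<noteq> 0" using inj[of "x / y" 1] ne assms by simp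
    moreover have "f x - f y \<noteq> 0" using inj[of x y] 3 assms by simp
    ultimately have "(f (x / y) + 1) * (f x - f y) = (f x + f y) * (f (x / y) - 1)"
      by (simp add: frac_eq_eq)
    then have "2 * (f (x / y) * f y) = 2 * f x" by (simp add: algebra_simps)
    then have "f (x / y) * f y = f x" by (simp only: mult_cancel_left) simp
    then show ?thesis using 3 assms by (simp add: field_simps)
  qed (use assms in simp_all)
qed

lemma f_mult: assumes "x \<in> F" "y \<in> F" shows "f (x * y) = f x * f y"
proof -
  have "f (inverse y) = inverse (f y)"
    using f_divide[of 1 y] assms by (simp add: inverse_eq_divide)
  then show ?thesis
    using f_divide[of x "inverse y"] assms by (simp add: divide_inverse)
qed

text \<open>The SD equation with denominators cleared; in this form it also covers
  \<open>x = y\<close>, where both sides are 0.\<close>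

lemma sum_diff:
  assumes "x \<in> F" "y \<in> F" shows "f (x + y) * (f x - f y) = f (x - y) * (f x + f y)"
proof (cases "x = y")
  case False
  then have "f x - f y \<noteq> 0" "f (x - y) \<noteq> 0" using inj[of x y] assms by auto
  moreover have "f (x + y) / f (x - y) = (f x + f y) / (f x - f y)"
    using quotient[of x y] f_divide[of "x + y" "x - y"] False assms by simp
  ultimately show ?thesis by (simp add: frac_eq_eq mult.commute)
qed simp

lemma f_two: "f 2 = 2"
proof -
  define a where "a = f 2"
  have ne: "a \<noteq> 0" "a - 1 \<noteq> 0" "f 5 \<noteq> 0" "a + 1 \<noteq> 0"
    using inj[of 2 1] inj[of 2 "-1"] by (auto simp: a_def add_eq_0_iff2)
  have f4: "f 4 = a * a" using f_mult[of 2 2] by (simp add: a_def)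
  have f3: "f 3 * (a - 1) = a + 1" using sum_diff[of 2 1] by (simp add: a_def)
  have f5: "f 5 * (f 3 - a) = f 3 + a" using sum_diff[of 3 2] by (simp add: a_def)
  have f5': "f 5 * (a * a - 1) = f 3 * (a * a + 1)" using sum_diff[of 4 1] f4 by simp
  \<comment> \<open>The extra factor \<open>a + 1\<close> produces \<open>a * a - 1\<close>, so that
    \<open>f5'\<close> applies. It cancels at the end because
    \<open>f 3 * (a - 1) = a + 1\<close>.\<close>
  have "f 5 * ((a - 1) * (a - 1)) * (a + 1) = f 5 * (a * a - 1) * (a - 1)"
    by (simp add: algebra_simps)
  also have "\<dots> = (f 3 * (a - 1)) * (a * a + 1)" unfolding f5' by (simp add: algebra_simps)
  finally have 1: "f 5 * ((a - 1) * (a - 1)) = a * a + 1" using ne f3 by simp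
  have "f 5 * (f 3 * (a - 1) - a * (a - 1)) = f 3 * (a - 1) + a * (a - 1)"
    using arg_cong[OF f5, of "\<lambda>t. t * (a - 1)"] by (simp add: algebra_simps)
  then have 2: "f 5 * (a + 1 - a * (a - 1)) = a * a + 1" unfolding f3 by (simp add: algebra_simps)
  \<comment> \<open>Cancelling \<open>f 5\<close> leaves a quadratic equation in \<open>a\<close>
    whose roots are 0 and 2.\<close>
  have "f 5 * ((a - 1) * (a - 1)) = f 5 * (a + 1 - a * (a - 1))" using 1 2 by simp
  then have "(a - 1) * (a - 1) = a + 1 - a * (a - 1)" using ne(3) by (simp only: mult_cancel_left) simp
  then have "2 * a * a = 2 * a * 2" by (simp add: algebra_simps)
  then show ?thesis using ne(1) by (simp only: mult_cancel_left a_def) simp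
qed

text \<open>By \<open>sum_diff\<close> at \<open>n - 1\<close> and 1, the values at
  \<open>n - 1\<close> and \<open>n - 2\<close> determine \<open>f n\<close>. The coefficient of
  \<open>f n\<close> is \<open>n - 2\<close>, which vanishes at \<open>n = 2\<close>, so
  \<open>f_two\<close> is needed as a base case.\<close>

lemma f_of_nat: "f (of_nat n) = of_nat n"
proof (induction n rule: less_induct)
  case (less n)
  consider "n = 0" | "n = 1" | "n = 2" | "n \<ge> 3" by linarith
  then show ?case
  proof cases
    case 4
    define m where "m = n - 2"
    have m: "m > 0" "n = m + 2" using 4 by (auto simp: m_def)
    have "f (of_nat n) * (of_nat (Suc m) - 1) = of_nat m * (of_nat (Suc m) + 1)"
      using sum_diff[of "of_nat (Suc m)" 1] less[of "Suc m"] less[of m] m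
      by (simp add: algebra_simps)
    then have "of_nat m * f (of_nat n) = of_nat m * of_nat n" using m by (simp add: algebra_simps)
    then show ?thesis using m by (simp only: mult_cancel_left) simp
  qed (use f_two in auto)
qed

lemma f_of_rat [simp]: "f (of_rat q) = of_rat q"
proof -
  have "f (of_int i) = of_int i" for i
    by (cases i rule: int_cases2) (auto simp: f_of_nat)
  then show ?thesis by (cases q) (simp add: of_rat_rat f_divide)
qed

end

lemma is_subfield_Rats: "is_subfield \<rat>"
  by (simp add: is_subfield_def)

lemma Euclidean_subfield_UNIV: "Euclidean_subfield UNIV"
proof -
  have "(sqrt x)\<^sup>2 = x" if "0 \<le> x" for x using that by simp
  then show ?thesis unfolding Euclidean_subfield_def is_subfield_def by blast
qed

lemma SD_map_Euclidean_imp_identity: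
  assumes "Euclidean_subfield F" "SD_map F f"
  shows "identity_map_on F f"
proof -
  interpret sd_map F f
    using assms by unfold_locales (simp_all add: Euclidean_subfield_def)
  have pos: "f x > 0" if x: "x \<in> F" "x > 0" for x
  proof -
    obtain y where "y \<in> F" "y\<^sup>2 = x"
      using assms(1) x by (meson Euclidean_subfield_def less_imp_le)
    then have "f x = (f y)\<^sup>2" using f_mult[of y y] by (auto simp: power2_eq_square)
    moreover have "f x \<noteq> 0" using x by simp
    ultimately show ?thesis by simp
  qed
  \<comment> \<open>In \<open>sum_diff\<close> at \<open>y\<close> and \<open>x\<close>,
    \<open>pos\<close> makes the right-hand side positive, and also the factor
    \<open>f (y + x)\<close> on the left.\<close>
  have mono: "f x < f y" if "x \<in> F" "y \<in> F" "0 < x" "x < y" for x y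
  proof -
    have "f (y + x) * (f y - f x) > 0"
      using sum_diff[of y x] pos[of "y - x"] pos[of x] pos[of y] that by (simp add: add_pos_pos)
    then show ?thesis using pos[of "y + x"] that by (simp add: zero_less_mult_iff)
  qed
  have fix_pos: "f x = x" if "x \<in> F" "x > 0" for x
  proof (rule ccontr)
    assume "f x \<noteq> x"
    then consider "f x < x" | "x < f x" by linarith
    then show False
    proof cases
      case 1
      then obtain q where "f x < of_rat q" "of_rat q < x" using of_rat_dense by blast
      \<comment> \<open>\<open>mono\<close> compares positive points only; \<open>q\<close>
        qualifies because it lies above the positive number \<open>f x\<close>.\<close>
      moreover have "(0 :: real) < of_rat q" using calculation pos[of x] that by linarith
      ultimately show False using mono[of "of_rat q" x] that by simp
    next
      case 2
      then obtain q where "x < of_rat q" "of_rat q < f x" using of_rat_dense by blast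
      then show False using mono[of x "of_rat q"] that by auto
    qed
  qed
  have "f x = x" if "x \<in> F" for x
    using fix_pos[of x] fix_pos[of "- x"] that by (cases x "0 :: real" rule: linorder_cases) auto
  then show ?thesis by (simp add: identity_map_on_def)
qed

section \<open>Quadratic extensions of the rationals\<close>

lemma quadratic_extension_of_ratE:
  assumes "quadratic_extension_of_rat (F :: 'a::field_char_0 set)"
  obtains d r where "r\<^sup>2 = of_rat d" "r \<notin> \<rat>" "F = {of_rat a + of_rat b * r | a b. True}"
proof -
  have sub: "is_subfield F" and dim: "rat_vector_space.dim F = 2"
    using assms by (auto simp: quadratic_extension_of_rat_def)
  have closed: "x + y \<in> F" "x * y \<in> F" if "x \<in> F" "y \<in> F" for x y
    using sub that by (auto simp: is_subfield_def)
  \<comment> \<open>The identity is an SD map on any subfield, so the closure facts of the locale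
    become available for \<open>F\<close>.\<close>
  have "sd_map F id" using sub by unfold_locales (auto simp: SD_map_def)
  then have rat: "of_rat q \<in> F" for q by (rule sd_map.of_rat_mem)
  \<comment> \<open>A basis containing 1 is wanted: its other element \<open>u\<close> is then
    irrational.\<close>
  have "rat_vector_space.independent {1}"
    using rat_vector_space.dependent_single[of 1] by simp
  moreover have "{1} \<subseteq> F" using rat[of 1] by simp
  ultimately obtain B where B: "{1} \<subseteq> B" "B \<subseteq> F" "rat_vector_space.independent B"
      "F \<subseteq> rat_vector_space.span B"
    using rat_vector_space.maximal_independent_subset_extend by metis
  have "card B = 2" using rat_vector_space.basis_card_eq_dim[OF B(2,4,3)] dim by simp
  then obtain u where u: "B = {1, u}" "u \<noteq> 1"
    using B(1) by (auto simp: card_2_iff)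
  have u_irr: "u \<notin> \<rat>"
  proof
    assume "u \<in> \<rat>"
    then obtain q where "u = of_rat q" by (auto elim: Rats_cases)
    then have "u \<in> rat_vector_space.span {1}"
      by (auto simp: rat_vector_space.span_singleton)
    then show False using B(3) u
      by (metis insertI1 insert_Diff_if insert_commute rat_vector_space.independent_insert singletonD)
  qed
  have repr: "\<exists>a b. x = of_rat a + of_rat b * u" if "x \<in> F" for x
  proof -
    from that B(4) u have "x \<in> rat_vector_space.span {1, u}" by blast
    then obtain a b where "x - of_rat a * 1 = of_rat b * u"
      by (auto simp: rat_vector_space.span_insert rat_vector_space.span_singleton)
    then have "x = of_rat a + of_rat b * u" by (simp add: algebra_simps)
    then show ?thesis by blast
  qed
  have uF: "u \<in> F" using B u by auto
  then obtain p q where pq: "u * u = of_rat p + of_rat q * u" using repr closed by blast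
  \<comment> \<open>Completing the square in \<open>pq\<close> removes the linear term.\<close>
  define r where "r = u - of_rat (q / 2)"
  show thesis
  proof (rule that)
    show "r\<^sup>2 = of_rat (p + q\<^sup>2 / 4)"
      by (simp add: r_def power2_eq_square of_rat_add of_rat_mult of_rat_divide algebra_simps pq)
    show "r \<notin> \<rat>"
      using u_irr Rats_add[of r "of_rat (q / 2)"] by (auto simp: r_def)
    show "F = {of_rat a + of_rat b * r | a b. True}"
    proof safe
      fix x assume "x \<in> F"
      then obtain a b where "x = of_rat a + of_rat b * u" using repr by blast
      then have "x = of_rat (a + b * (q / 2)) + of_rat b * r"
        by (simp add: r_def of_rat_add of_rat_mult of_rat_divide algebra_simps)
      then show "\<exists>a b. x = of_rat a + of_rat b * r \<and> True" by blast
    next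
      fix a b
      have "of_rat a + of_rat b * r = of_rat (a - b * (q / 2)) + of_rat b * u"
        by (simp add: r_def of_rat_diff of_rat_mult of_rat_divide algebra_simps)
      then show "of_rat a + of_rat b * r \<in> F" using closed rat uF by metis
    qed
  qed
qed

text \<open>For \<open>b \<noteq> 0\<close>, let \<open>x\<close> and \<open>y\<close> be
  \<open>a + b r\<close> and \<open>a - b r\<close>. Since \<open>x * y\<close> is rational,
  \<open>f x * f y\<close> has the expected value; \<open>sum_diff\<close> does the same for the
  ratio of \<open>f x\<close> to \<open>f y\<close>. Together they fix \<open>f x\<close> up to
  sign.\<close>

lemma (in sd_map) f_quadratic:
  assumes r: "r \<in> F" "r\<^sup>2 = of_rat d" "r \<notin> \<rat>"
  shows "f (of_rat a + of_rat b * r) = of_rat a + of_rat b * f r"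
proof -
  define s where "s = f r"
  define S where "S a b = of_rat a + of_rat b * s" for a b
  have rr: "r * r = of_rat d" using r(2) by (simp add: power2_eq_square)
  then have s2: "s * s = of_rat d"
    using f_mult[of r r] r(1) by (simp add: s_def)
  with rr have "s * s = r * r" by simp
  then have "s = r \<or> s = - r" by (simp add: square_eq_iff)
  then have s_irr: "s \<notin> \<rat>" using r(3) by auto
  have S_irr: "S a b \<notin> \<rat>" if "b \<noteq> 0" for a b
  proof
    assume "S a b \<in> \<rat>"
    then have "(S a b - of_rat a) / of_rat b \<in> \<rat>" by simp
    with that s_irr show False by (simp add: S_def)
  qed
  have sign: "f (of_rat a + of_rat b * r) = S a b \<or> f (of_rat a + of_rat b * r) = - S a b" for a b
  proof (cases "b = 0")
    case False
    let ?x = "of_rat a + of_rat b * r" and ?y = "of_rat a - of_rat b * r"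
    have fbr: "f (of_rat b * r) = of_rat b * s" using r by (simp add: f_mult s_def)
    have "f ?x * f ?y = f (?x * ?y)" using r by (simp add: f_mult)
    also have "?x * ?y = of_rat a * of_rat a - of_rat b * of_rat b * (r * r)"
      by (simp add: algebra_simps)
    also have "\<dots> = of_rat (a * a - b * b * d)"
      unfolding rr by (simp add: of_rat_mult of_rat_diff)
    also have "f \<dots> = of_rat a * of_rat a - of_rat b * of_rat b * (s * s)"
      unfolding f_of_rat s2 by (simp add: of_rat_mult of_rat_diff)
    also have "\<dots> = S a b * S a (- b)"
      by (simp add: S_def of_rat_minus algebra_simps)
    finally have 1: "f ?x * f ?y = S a b * S a (- b)" .
    have 2: "f ?x * S a (- b) = f ?y * S a b"
      using sum_diff[of "of_rat a" "of_rat b * r"] r fbr by (simp add: S_def of_rat_minus)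
    have "f ?x * f ?x * S a (- b) = f ?x * f ?y * S a b"
      using 2 by (simp add: mult.assoc)
    also have "\<dots> = S a b * S a b * S a (- b)" unfolding 1 by (simp add: ac_simps)
    finally have "f ?x * f ?x = S a b * S a b"
      using S_irr[of "- b" a] False by auto
    then show ?thesis by (simp add: square_eq_iff)
  qed (simp add: S_def)
  \<comment> \<open>\<open>sum_diff\<close> is applied to \<open>x\<close> and 1, with the values at
    \<open>x + 1\<close> and \<open>x - 1\<close> known up to sign. Equal signs force
    \<open>4 * t = 0\<close>, which irrationality of \<open>t\<close> excludes; opposite signs force
    \<open>t * t = - 1\<close>.\<close>
  have minus_one: "S a b * S a b = - 1"
    if b: "b \<noteq> 0" and neg: "f (of_rat a + of_rat b * r) = - S a b" for a b
  proof -
    let ?x = "of_rat a + of_rat b * r" and ?t = "S a b"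
    have "f (?x + 1) * (- ?t - 1) = f (?x - 1) * (- ?t + 1)"
      using sum_diff[of ?x 1] neg r by simp
    moreover have "f (?x + 1) = ?t + 1 \<or> f (?x + 1) = - (?t + 1)"
      using sign[of "a + 1" b] by (simp add: S_def of_rat_add algebra_simps)
    moreover have "f (?x - 1) = ?t - 1 \<or> f (?x - 1) = - (?t - 1)"
      using sign[of "a - 1" b] by (simp add: S_def of_rat_diff algebra_simps)
    moreover have "4 * t = 0 \<or> 2 * (t * t + 1) = 0"
      if "p * (- t - 1) = q * (- t + 1)" "p = t + 1 \<or> p = - (t + 1)" "q = t - 1 \<or> q = - (t - 1)"
      for p q t :: 'a
      using that by (elim disjE; hypsubst; algebra)
    ultimately have "4 * ?t = 0 \<or> 2 * (?t * ?t + 1) = 0" by blast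
    moreover have "?t \<noteq> 0" using S_irr[OF b, of a] by auto
    ultimately show ?thesis by (metis eq_neg_iff_add_eq_0 mult_eq_0_iff zero_neq_numeral)
  qed
  show ?thesis
  proof (rule ccontr)
    assume "\<not> ?thesis"
    then have neg: "f (of_rat a + of_rat b * r) \<noteq> S a b" by (simp add: S_def s_def)
    then have b: "b \<noteq> 0" by (auto simp: S_def)
    have neg1: "f (of_rat a + of_rat b * r) = - S a b" using neg sign by blast
    \<comment> \<open>Since \<open>f\<close> is multiplicative and fixes 2, a negative sign at
      \<open>x\<close> persists at \<open>2 * x\<close>, so \<open>minus_one\<close> applies to both
      points.\<close>
    have S2: "S (2 * a) (2 * b) = 2 * S a b"
      by (simp add: S_def of_rat_mult algebra_simps)
    have "of_rat (2 * a) + of_rat (2 * b) * r = 2 * (of_rat a + of_rat b * r)"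
      by (simp add: of_rat_mult algebra_simps)
    then have "f (of_rat (2 * a) + of_rat (2 * b) * r) = - S (2 * a) (2 * b)"
      using f_mult[of 2 "of_rat a + of_rat b * r"] r(1) neg1 by (simp only: S2) (simp add: f_two)
    from minus_one[OF _ this] b have "4 * (S a b * S a b) = - 1"
      unfolding S2 by (simp add: algebra_simps)
    then show False using minus_one[OF b neg1] by simp
  qed
qed

lemma SD_map_quadratic_imp_identity_or_conjugate:
  assumes "quadratic_extension_of_rat F" "SD_map F f"
  shows "identity_map_on F f \<or> conjugate_map_on F f"
proof -
  interpret sd_map F f
    using assms by unfold_locales (simp_all add: quadratic_extension_of_rat_def)
  obtain d r where r: "r\<^sup>2 = of_rat d" "r \<notin> \<rat>" "F = {of_rat a + of_rat b * r | a b. True}"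
    using quadratic_extension_of_ratE[OF assms(1)] .
  have "r = of_rat 0 + of_rat 1 * r" by simp
  then have rF: "r \<in> F" using r(3) by blast
  note f_eq = f_quadratic[OF rF r(1,2)]
  have "f r * f r = r * r"
    using f_mult[OF rF rF] r(1) by (simp add: power2_eq_square)
  then consider "f r = r" | "f r = - r" by (auto simp: square_eq_iff)
  then show ?thesis
  proof cases
    case 1
    then have "identity_map_on F f"
      using f_eq r(3) by (auto simp: identity_map_on_def)
    then show ?thesis ..
  next
    case 2
    then have "conjugate_map_on F f"
      unfolding conjugate_map_on_def using f_eq r by (intro exI[of _ d] exI[of _ r]) simp
    then show ?thesis ..
  qed
qed

theorem theorem1p1:
  shows "(\<forall>(F :: real set) f. SD_map F f \<and>
            (F = \<rat> \<or> F = UNIV \<or> Euclidean_subfield F) \<longrightarrow>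
            identity_map_on F f) \<and>
         (\<forall>(F :: 'a::field_char_0 set) f. SD_map F f \<and>
            quadratic_extension_of_rat F \<longrightarrow>
            identity_map_on F f \<or> conjugate_map_on F f)"
proof -
  have "identity_map_on \<rat> f" if "SD_map \<rat> f" for f :: "real \<Rightarrow> real"
  proof -
    interpret sd_map \<rat> f using that is_subfield_Rats by unfold_locales
    show ?thesis by (auto simp: identity_map_on_def elim: Rats_cases)
  qed
  then show ?thesis
    using SD_map_Euclidean_imp_identity Euclidean_subfield_UNIV
      SD_map_quadratic_imp_identity_or_conjugate
    by blast
qed

end
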